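(* Let $a,b,c,d\in\mathbb{R}$ and let $\phi:\left(\mathbb{R}^2,\frac{4(dx^2+dy^2)}{(1+x^2+y^2)^2}\right)\to\left(\mathbb{R}^2,\frac{4(du^2+dv^2)}{(1+u^2+v^2)^2}\right)$ be the linear map $\phi(x,y)=(ax+by,cx+dy)$ (a linear map between $2$-spheres, each modelled as $S^2\setminus\{N\}$ in these coordinates). Then $\phi$ is biharmonic if and only if it is harmonic, i.e. if and only if $\phi$ is a constant map, or $|A^1|^2=|A^2|^2$ and $A^1\cdot A^2=0$, where $A^1=(a,b)$ and $A^2=(c,d)$.
   Context: For a smooth map $\phi:(M,g)\to(N,h)$ between Riemannian manifolds the tension field is $\tau(\phi)=\mathrm{Trace}_g\nabla d\phi$; $\phi$ is harmonic if $\tau(\phi)=0$. It is biharmonic if it is a critical point of $\frac12\int_\Omega|\tau(\phi)|^2v_g$ for every compact $\Omega\subset M$, equivalently if $$\tau^2(\phi)=\mathrm{Trace}_g\big(\nabla^\phi\nabla^\phi-\nabla^\phi_{\nabla^M}\big)\tau(\phi)-\mathrm{Trace}_g R^N(d\phi,\tau(\phi))\,d\phi=0,$$ with $R^N(X,Y)Z=[\nabla^N_X,\nabla^N_Y]Z-\nabla^N_{[X,Y]}Z$. $|\cdot|$ and $\cdot$ on $A^1,A^2$ are the Euclidean norm and dot product. $S^2\setminus\{N\}$ denotes the sphere minus a pole, identified with $\mathbb{R}^2$ with the indicated metric. *)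

theory Defs
  imports "HOL-Analysis.Analysis"
begin

text \<open>
  Riemannian geometry in one global chart: a manifold is \<open>real^'n\<close> with a metric
  \<open>g\<close>, given by its Gram matrix \<open>g x $ i $ j = g(\<partial>\<^sub>i, \<partial>\<^sub>j)\<close> at \<open>x\<close>. Vector fields, and vector
  fields along a map \<open>\<phi>\<close>, are given by their components in the coordinate frame (of the target,
  at \<open>\<phi> x\<close>, in the second case). The operators below have their geometric meaning for
  smooth metrics, maps and fields.
\<close>

type_synonym 'n metric = "real^'n \<Rightarrow> real^'n^'n"
type_synonym ('m, 'n) field = "real^'m \<Rightarrow> real^'n"

definition partial_deriv :: "'m::finite \<Rightarrow> (real^'m \<Rightarrow> real) \<Rightarrow> real^'m \<Rightarrow> real" where
  "partial_deriv i f x = deriv (\<lambda>t. f (x + t *\<^sub>R axis i 1)) 0"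

definition coord_field :: "'m::finite \<Rightarrow> ('m, 'm) field" where
  "coord_field i = (\<lambda>x. axis i 1)"

definition christoffel :: "'n::finite metric \<Rightarrow> 'n \<Rightarrow> 'n \<Rightarrow> 'n \<Rightarrow> real^'n \<Rightarrow> real" where
  "christoffel g k i j x =
     (\<Sum>l\<in>UNIV. matrix_inv (g x) $ k $ l *
        (partial_deriv i (\<lambda>y. g y $ j $ l) x + partial_deriv j (\<lambda>y. g y $ i $ l) x
         - partial_deriv l (\<lambda>y. g y $ i $ j) x)) / 2"

definition levi_civita ::
    "'m::finite metric \<Rightarrow> ('m, 'm) field \<Rightarrow> ('m, 'm) field \<Rightarrow> ('m, 'm) field" where
  "levi_civita g X Y x = (\<chi> k.
     (\<Sum>i\<in>UNIV. X x $ i * partial_deriv i (\<lambda>y. Y y $ k) x) +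
     (\<Sum>i\<in>UNIV. \<Sum>j\<in>UNIV. christoffel g k i j x * X x $ i * Y x $ j))"

definition lie_bracket :: "('m::finite, 'm) field \<Rightarrow> ('m, 'm) field \<Rightarrow> ('m, 'm) field" where
  "lie_bracket X Y x = (\<chi> k.
     \<Sum>i\<in>UNIV. X x $ i * partial_deriv i (\<lambda>y. Y y $ k) x
              - Y x $ i * partial_deriv i (\<lambda>y. X y $ k) x)"

definition curvature ::
    "'m::finite metric \<Rightarrow> ('m, 'm) field \<Rightarrow> ('m, 'm) field \<Rightarrow> ('m, 'm) field \<Rightarrow> ('m, 'm) field" where
  "curvature g X Y Z x =
     levi_civita g X (levi_civita g Y Z) x - levi_civita g Y (levi_civita g X Z) x
     - levi_civita g (lie_bracket X Y) Z x"

text \<open>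
  The curvature is tensorial, so its value on tangent vectors \<open>u\<close>, \<open>v\<close>, \<open>w\<close> at \<open>p\<close> can be computed
  with any extensions to fields; we take those with constant components.
\<close>

definition curvature_at ::
    "'m::finite metric \<Rightarrow> real^'m \<Rightarrow> real^'m \<Rightarrow> real^'m \<Rightarrow> real^'m \<Rightarrow> real^'m" where
  "curvature_at g p u v w = curvature g (\<lambda>_. u) (\<lambda>_. v) (\<lambda>_. w) p"

definition differential ::
    "(real^'m::finite \<Rightarrow> real^'n::finite) \<Rightarrow> ('m, 'm) field \<Rightarrow> ('m, 'n) field" where
  "differential \<phi> X x = (\<chi> k. \<Sum>i\<in>UNIV. X x $ i * partial_deriv i (\<lambda>y. \<phi> y $ k) x)"

text \<open>The connection \<open>\<nabla>\<^sup>\<phi>\<close> on fields along \<open>\<phi>\<close> induced by the Levi-Civita connection of the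
  target metric \<open>h\<close>.\<close>

definition pullback_connection ::
    "'n::finite metric \<Rightarrow> (real^'m::finite \<Rightarrow> real^'n) \<Rightarrow> ('m, 'm) field \<Rightarrow>
     ('m, 'n) field \<Rightarrow> ('m, 'n) field" where
  "pullback_connection h \<phi> X V x = (\<chi> k.
     (\<Sum>i\<in>UNIV. X x $ i * partial_deriv i (\<lambda>y. V y $ k) x) +
     (\<Sum>i\<in>UNIV. \<Sum>j\<in>UNIV. christoffel h k i j (\<phi> x) * differential \<phi> X x $ i * V x $ j))"

definition metric_trace ::
    "'m::finite metric \<Rightarrow> (('m, 'm) field \<Rightarrow> ('m, 'm) field \<Rightarrow> ('m, 'n::finite) field) \<Rightarrow>
     ('m, 'n) field" where
  "metric_trace g B x =
     (\<Sum>i\<in>UNIV. \<Sum>j\<in>UNIV. matrix_inv (g x) $ i $ j *\<^sub>R B (coord_field i) (coord_field j) x)"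

definition second_fundamental_form ::
    "'m::finite metric \<Rightarrow> 'n::finite metric \<Rightarrow> (real^'m \<Rightarrow> real^'n) \<Rightarrow>
     ('m, 'm) field \<Rightarrow> ('m, 'm) field \<Rightarrow> ('m, 'n) field" where
  "second_fundamental_form g h \<phi> X Y x =
     pullback_connection h \<phi> X (differential \<phi> Y) x - differential \<phi> (levi_civita g X Y) x"

definition tension_field ::
    "'m::finite metric \<Rightarrow> 'n::finite metric \<Rightarrow> (real^'m \<Rightarrow> real^'n) \<Rightarrow> ('m, 'n) field" where
  "tension_field g h \<phi> = metric_trace g (second_fundamental_form g h \<phi>)"

definition second_covariant_derivative ::
    "'m::finite metric \<Rightarrow> 'n::finite metric \<Rightarrow> (real^'m \<Rightarrow> real^'n) \<Rightarrow> ('m, 'n) field \<Rightarrow>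
     ('m, 'm) field \<Rightarrow> ('m, 'm) field \<Rightarrow> ('m, 'n) field" where
  "second_covariant_derivative g h \<phi> V X Y x =
     pullback_connection h \<phi> X (pullback_connection h \<phi> Y V) x
     - pullback_connection h \<phi> (levi_civita g X Y) V x"

definition bitension_field ::
    "'m::finite metric \<Rightarrow> 'n::finite metric \<Rightarrow> (real^'m \<Rightarrow> real^'n) \<Rightarrow> ('m, 'n) field" where
  "bitension_field g h \<phi> x =
     metric_trace g (second_covariant_derivative g h \<phi> (tension_field g h \<phi>)) x
     - metric_trace g (\<lambda>X Y y. curvature_at h (\<phi> y)
         (differential \<phi> X y) (tension_field g h \<phi> y) (differential \<phi> Y y)) x"

definition harmonic_map ::
    "'m::finite metric \<Rightarrow> 'n::finite metric \<Rightarrow> (real^'m \<Rightarrow> real^'n) \<Rightarrow> bool" where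
  "harmonic_map g h \<phi> \<longleftrightarrow> (\<forall>x. tension_field g h \<phi> x = 0)"

text \<open>Biharmonicity is taken as the Euler-Lagrange equation of the bienergy
  \<open>\<phi> \<mapsto> 1/2 \<integral> \<bar>\<tau>(\<phi>)\<bar>\<^sup>2 v\<^sub>g\<close>.\<close>

definition biharmonic_map ::
    "'m::finite metric \<Rightarrow> 'n::finite metric \<Rightarrow> (real^'m \<Rightarrow> real^'n) \<Rightarrow> bool" where
  "biharmonic_map g h \<phi> \<longleftrightarrow> (\<forall>x. bitension_field g h \<phi> x = 0)"

text \<open>The round metric of the unit sphere minus a pole in stereographic coordinates.\<close>

definition sphere_metric :: "2 metric" where
  "sphere_metric p = (4 / (1 + (p $ 1)\<^sup>2 + (p $ 2)\<^sup>2)\<^sup>2) *\<^sub>R mat 1"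

end

theory Submission
  imports Defs
begin

text \<open>
  Identify \<open>\<real>\<^sup>2\<close> with the complex plane. The round metric is conformal, so its Christoffel symbols
  become the single complex function \<open>\<Gamma>(p) = - 2 cnj p / (1 + \<bar>p\<bar>\<^sup>2)\<close>, acting by multiplication,
  and the curvature is \<open>R(u,v)w = - 2 (cnj u v - u cnj v) w / (1 + \<bar>p\<bar>\<^sup>2)\<^sup>2\<close>. As the domain is
  a surface in isothermal coordinates, the terms \<open>\<nabla>\<^sub>\<partial>\<^sub>i \<partial>\<^sub>i\<close> cancel in every trace.

  Write the linear map as \<open>w = A\<^sub>1 x + A\<^sub>2 y\<close> with complex coefficients and put
  \<open>H = A\<^sub>1\<^sup>2 + A\<^sub>2\<^sup>2\<close>. In terms of the rows of the real matrix the real part of \<open>H\<close> is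
  \<open>\<bar>A\<^sup>1\<bar>\<^sup>2 - \<bar>A\<^sup>2\<bar>\<^sup>2\<close> and its imaginary part is \<open>2 A\<^sup>1 \<bullet> A\<^sup>2\<close>, so \<open>H = 0\<close> is conformality of the
  linear map (the zero map included). The tension field is \<open>- (H / 2) \<rho> cnj w\<close> with
  \<open>\<rho> = (1 + x\<^sup>2 + y\<^sup>2)\<^sup>2 / (1 + \<bar>w\<bar>\<^sup>2)\<close> (\<open>tension_cpx\<close>), hence harmonicity means \<open>H = 0\<close>.

  Since \<open>H\<close> is constant it also factors out of the bitension field (\<open>bitension_cpx\<close>), and what
  remains is a complex factor \<open>T\<close> that would have to vanish identically if the map were
  biharmonic with \<open>H \<noteq> 0\<close>. Far out along the \<open>i\<close>-th axis, if \<open>A\<^sub>i \<noteq> 0\<close>,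
  \<open>T / t\<close> tends to \<open>(12 H - 8 A\<^sub>i\<^sup>2) / A\<^sub>i\<^sup>3\<close>, so \<open>2 A\<^sub>i\<^sup>2 = 3 H\<close>
  (\<open>bitension_factor_zero_imp\<close>). Thus each \<open>2 A\<^sub>i\<^sup>2\<close> is \<open>0\<close> or \<open>3 H\<close>, while the two add up to
  \<open>2 H\<close>; this forces \<open>H = 0\<close>.
\<close>

section \<open>Complex coordinates and partial derivatives\<close>

definition cpx :: "real^2 \<Rightarrow> complex" where
  "cpx v = Complex (v $ 1) (v $ 2)"

lemma cpx_sel [simp]: "Re (cpx v) = v $ 1" "Im (cpx v) = v $ 2"
  by (simp_all add: cpx_def)

lemma cpx_eq_iff: "cpx u = cpx v \<longleftrightarrow> u = v"
  by (simp add: cpx_def vec_eq_iff forall_2)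

lemma cpx_zero [simp]: "cpx 0 = 0" and cpx_add: "cpx (u + v) = cpx u + cpx v"
  and cpx_diff: "cpx (u - v) = cpx u - cpx v" and cpx_scaleR: "cpx (r *\<^sub>R v) = r *\<^sub>R cpx v"
  by (simp_all add: complex_eq_iff)

lemma cpx_eq_0_iff: "cpx v = 0 \<longleftrightarrow> v = 0"
  using cpx_eq_iff[of v 0] by simp

text \<open>
  Differentiability of the restriction to a coordinate line is all that \<open>partial_deriv\<close> sees. The
  relational form keeps existence and value together, and allows complex-valued functions, for
  which the product rule replaces componentwise computation.
\<close>

definition has_partial ::
    "(real^'m::finite \<Rightarrow> 'b::real_normed_vector) \<Rightarrow> 'b \<Rightarrow> 'm \<Rightarrow> real^'m \<Rightarrow> bool" where
  "has_partial f D i x \<longleftrightarrow> ((\<lambda>t. f (x + t *\<^sub>R axis i 1)) has_vector_derivative D) (at 0)"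

lemma partial_deriv_eqI: "has_partial f D i x \<Longrightarrow> partial_deriv i f x = D"
  unfolding has_partial_def partial_deriv_def
  by (simp add: has_real_derivative_iff_has_vector_derivative[symmetric] DERIV_imp_deriv)

lemma has_partial_const: "has_partial (\<lambda>_. k) 0 i x"
  by (simp add: has_partial_def)

lemma has_partial_add:
  "has_partial f D i x \<Longrightarrow> has_partial g E i x \<Longrightarrow> has_partial (\<lambda>y. f y + g y) (D + E) i x"
  by (simp add: has_partial_def has_vector_derivative_add)

lemma has_partial_minus:
  fixes f g :: "real^'m::finite \<Rightarrow> 'b::real_normed_algebra"
  shows "has_partial f D i x \<Longrightarrow> has_partial g E i x \<Longrightarrow> has_partial (\<lambda>y. f y - g y) (D - E) i x"
  by (simp add: has_partial_def has_vector_derivative_diff)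

lemma has_partial_mult:
  fixes f g :: "real^'m::finite \<Rightarrow> 'b::real_normed_algebra"
  shows "has_partial f D i x \<Longrightarrow> has_partial g E i x \<Longrightarrow>
    has_partial (\<lambda>y. f y * g y) (f x * E + D * g x) i x"
  unfolding has_partial_def by (drule (1) has_vector_derivative_mult) simp

lemma has_partial_linear:
  "bounded_linear L \<Longrightarrow> has_partial f D i x \<Longrightarrow> has_partial (\<lambda>y. L (f y)) (L D) i x"
  unfolding has_partial_def by (rule bounded_linear.has_vector_derivative)

lemma has_partial_divide:
  fixes f g :: "real^'m::finite \<Rightarrow> real"
  shows "has_partial f D i x \<Longrightarrow> has_partial g E i x \<Longrightarrow> g x \<noteq> 0 \<Longrightarrow>
    has_partial (\<lambda>y. f y / g y) ((D * g x - f x * E) / (g x * g x)) i x"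
  unfolding has_partial_def has_real_derivative_iff_has_vector_derivative[symmetric]
  by (drule (1) DERIV_divide) simp_all

lemma has_partial_nth: "has_partial (\<lambda>y. y $ j) (if i = j then 1 else 0) i x"
  unfolding has_partial_def has_real_derivative_iff_has_vector_derivative[symmetric]
  by (auto intro!: derivative_eq_intros simp: axis_def)

lemma has_partial_eqI: "has_partial f D i x \<Longrightarrow> D = E \<Longrightarrow> has_partial f E i x"
  by simp

definition cpx_partial :: "'m::finite \<Rightarrow> ('m, 2) field \<Rightarrow> real^'m \<Rightarrow> complex" where
  "cpx_partial i V x = Complex (partial_deriv i (\<lambda>y. V y $ 1) x)
     (partial_deriv i (\<lambda>y. V y $ 2) x)"

lemma cpx_partial_eqI: "has_partial (\<lambda>y. cpx (V y)) D i x \<Longrightarrow> cpx_partial i V x = D"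
  using has_partial_linear[OF bounded_linear_Re, of "\<lambda>y. cpx (V y)" D i x]
    has_partial_linear[OF bounded_linear_Im, of "\<lambda>y. cpx (V y)" D i x]
  by (auto simp: cpx_partial_def complex_eq_iff intro!: partial_deriv_eqI)

lemmas has_partial_cnj = has_partial_linear[OF bounded_linear_cnj]
lemmas has_partial_of_real = has_partial_linear[OF bounded_linear_of_real]
lemmas has_partial_Re = has_partial_linear[OF bounded_linear_Re]

section \<open>The sphere in stereographic coordinates\<close>

definition conf :: "real^2 \<Rightarrow> real" where
  "conf p = 1 + (norm (cpx p))\<^sup>2"

lemma conf_eq: "conf p = 1 + (p $ 1)\<^sup>2 + (p $ 2)\<^sup>2"
  by (simp add: conf_def cmod_power2)

lemma conf_pos: "conf p > 0"
  by (simp add: conf_def add_pos_nonneg)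

lemma conf_nonzero [simp]: "conf p \<noteq> 0"
  using conf_pos[of p] by simp

lemma of_real_conf: "of_real (conf p) = 1 + cpx p * cnj (cpx p)"
  unfolding complex_norm_square[symmetric] conf_def by simp

lemma has_partial_conf_comp:
  assumes "has_partial (\<lambda>y. cpx (\<phi> y)) w i x"
  shows "has_partial (\<lambda>y. conf (\<phi> y)) (2 * Re (cnj (cpx (\<phi> x)) * w)) i x"
proof -
  have "has_partial (\<lambda>y. 1 + Re (cpx (\<phi> y) * cnj (cpx (\<phi> y)))) (2 * Re (cnj (cpx (\<phi> x)) * w)) i x"
    by (rule has_partial_eqI, (rule has_partial_add has_partial_const has_partial_Re
        has_partial_mult has_partial_cnj assms)+) (simp add: algebra_simps)
  thus ?thesis by (simp add: conf_eq power2_eq_square add.assoc)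
qed

lemma has_partial_cpx: "has_partial cpx (cpx (axis i 1)) i p"
  unfolding has_partial_def cpx_add cpx_scaleR
  by (auto intro!: derivative_eq_intros)

lemma has_partial_conf: "has_partial conf (2 * (p $ i)) i p"
  using has_partial_conf_comp[of "\<lambda>y. y" _ i p, OF has_partial_cpx] exhaust_2[of i]
  by (auto simp: axis_def)

lemma matrix_inv_scaleR_mat_1:
  fixes r :: real
  assumes "r \<noteq> 0"
  shows "matrix_inv (r *\<^sub>R mat 1 :: real^'n^'n) = (1 / r) *\<^sub>R mat 1"
proof -
  have mult: "(s *\<^sub>R mat 1) ** M = s *\<^sub>R M" "M ** (s *\<^sub>R mat 1) = s *\<^sub>R M"
    for s :: real and M :: "real^'n^'n"
    by (simp_all add: matrix_matrix_mult_def mat_def vec_eq_iff if_distrib if_distribR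
        sum.delta' sum.delta cong: if_cong)
  show ?thesis
    unfolding matrix_inv_def
  proof (rule some_equality)
    show "M = (1 / r) *\<^sub>R mat 1"
      if "(r *\<^sub>R mat 1) ** M = mat 1 \<and> M ** (r *\<^sub>R mat 1) = mat 1" for M :: "real^'n^'n"
    proof -
      have "r *\<^sub>R M = mat 1" using that by (simp add: mult)
      hence "(1 / r) *\<^sub>R (r *\<^sub>R M) = (1 / r) *\<^sub>R mat 1" by simp
      thus ?thesis using assms by simp
    qed
  qed (use assms in \<open>simp add: mult\<close>)
qed

lemma matrix_inv_sphere: "matrix_inv (sphere_metric p) = ((conf p)\<^sup>2 / 4) *\<^sub>R mat 1"
  using conf_pos[of p]
  by (simp add: sphere_metric_def conf_eq[symmetric] matrix_inv_scaleR_mat_1)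

text \<open>The Christoffel symbol \<open>\<partial> log h / \<partial>w\<close> of the Kaehler metric \<open>h = 4 / (1 + \<bar>w\<bar>\<^sup>2)\<^sup>2\<close>.\<close>

definition gam :: "real^2 \<Rightarrow> complex" where
  "gam p = of_real (- 2 / conf p) * cnj (cpx p)"

lemma partial_deriv_sphere_metric:
  "partial_deriv i (\<lambda>y. sphere_metric y $ j $ l) x =
     (if j = l then - 16 * x $ i / conf x ^ 3 else 0)"
proof -
  have "has_partial (\<lambda>y. 4 / (conf y * conf y) * mat 1 $ j $ l)
      (if j = l then - 16 * x $ i / conf x ^ 3 else 0) i x"
    by (rule has_partial_eqI, (rule has_partial_mult has_partial_divide has_partial_const
        has_partial_conf | (simp; fail))+)
      (simp add: mat_def power3_eq_cube divide_simps)
  moreover have "sphere_metric y $ j $ l = 4 / (conf y * conf y) * mat 1 $ j $ l" for y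
    by (simp add: sphere_metric_def conf_eq power2_eq_square)
  ultimately show ?thesis by (simp only: partial_deriv_eqI)
qed

lemma christoffel_sphere:
  "christoffel sphere_metric k i j x =
     - 2 / conf x * ((if k = j then x $ i else 0) + (if k = i then x $ j else 0)
       - (if i = j then x $ k else 0))"
proof -
  have "christoffel sphere_metric k i j x = (conf x)\<^sup>2 / 8 *
    ((if k = j then - 16 * x $ i / conf x ^ 3 else 0)
     + (if k = i then - 16 * x $ j / conf x ^ 3 else 0)
     - (if i = j then - 16 * x $ k / conf x ^ 3 else 0))"
    using exhaust_2[of i] exhaust_2[of j] exhaust_2[of k]
    unfolding christoffel_def matrix_inv_sphere partial_deriv_sphere_metric
    by (auto simp: mat_def sum_2)
  also have "\<dots> = - 2 / conf x * ((if k = j then x $ i else 0) + (if k = i then x $ j else 0)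
       - (if i = j then x $ k else 0))"
    using conf_pos[of x] by (auto simp: field_simps power2_eq_square power3_eq_cube)
  finally show ?thesis .
qed

text \<open>
  On a complex curve with a Hermitian metric the Levi-Civita connection is complex linear,
  which is why the symmetric bilinear map given by the real Christoffel symbols is complex
  multiplication.
\<close>

lemma christoffel_sphere_cpx:
  fixes X Y p :: "real^2"
  shows "Complex (\<Sum>i\<in>UNIV. \<Sum>j\<in>UNIV. christoffel sphere_metric 1 i j p * X $ i * Y $ j)
     (\<Sum>i\<in>UNIV. \<Sum>j\<in>UNIV. christoffel sphere_metric 2 i j p * X $ i * Y $ j)
    = gam p * cpx X * cpx Y"
  using conf_pos[of p]
  by (simp add: sum_2 christoffel_sphere gam_def complex_eq_iff) (simp add: field_simps)

text \<open>
  The next three formulas hold even where the partial derivatives do not exist, since both sides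
  contain the same terms \<open>partial_deriv\<close>. This makes linearity in the direction field available
  without any smoothness.
\<close>

lemma differential_cpx:
  "cpx (differential \<phi> X x) = (\<Sum>i\<in>UNIV. X x $ i *\<^sub>R cpx_partial i \<phi> x)"
  by (simp add: complex_eq_iff differential_def cpx_partial_def)

lemma pullback_connection_cpx:
  "cpx (pullback_connection sphere_metric \<phi> X V x) =
     (\<Sum>i\<in>UNIV. X x $ i *\<^sub>R cpx_partial i V x) +
     gam (\<phi> x) * cpx (differential \<phi> X x) * cpx (V x)"
  unfolding christoffel_sphere_cpx[symmetric]
  by (simp add: complex_eq_iff pullback_connection_def cpx_partial_def)

lemma levi_civita_cpx:
  "cpx (levi_civita sphere_metric X Y x) =
     (\<Sum>i\<in>UNIV. X x $ i *\<^sub>R cpx_partial i Y x) + gam x * cpx (X x) * cpx (Y x)"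
  unfolding christoffel_sphere_cpx[symmetric]
  by (simp add: complex_eq_iff levi_civita_def cpx_partial_def)

lemma sum_axis_scaleR:
  fixes f :: "'m::finite \<Rightarrow> 'b::real_vector"
  shows "(\<Sum>j\<in>UNIV. axis i 1 $ j *\<^sub>R f j) = f i"
proof -
  have "(\<Sum>j\<in>UNIV. axis i 1 $ j *\<^sub>R f j) = (\<Sum>j\<in>UNIV. if j = i then f j else 0)"
    by (rule sum.cong) (auto simp: axis_def)
  thus ?thesis by simp
qed

lemma differential_coord_cpx:
  assumes "has_partial (\<lambda>y. cpx (\<phi> y)) w i x"
  shows "cpx (differential \<phi> (coord_field i) x) = w"
  by (simp add: differential_cpx coord_field_def sum_axis_scaleR cpx_partial_eqI[OF assms])

lemma pullback_connection_coord_cpx: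
  assumes "has_partial (\<lambda>y. cpx (\<phi> y)) w i x" "has_partial (\<lambda>y. cpx (V y)) D i x"
  shows "cpx (pullback_connection sphere_metric \<phi> (coord_field i) V x) =
    D + gam (\<phi> x) * w * cpx (V x)"
  unfolding pullback_connection_cpx differential_coord_cpx[OF assms(1)]
  by (simp add: coord_field_def sum_axis_scaleR cpx_partial_eqI[OF assms(2)])

text \<open>The numerator simplifies by \<open>(1 + \<bar>u\<bar>\<^sup>2) - \<bar>u\<bar>\<^sup>2 = 1\<close> for \<open>u = \<phi> x\<close>.\<close>

lemma has_partial_gam_comp:
  assumes "has_partial (\<lambda>y. cpx (\<phi> y)) w i x"
  shows "has_partial (\<lambda>y. gam (\<phi> y))
    (- 2 * (cnj w - (cnj (cpx (\<phi> x)))\<^sup>2 * w) / (of_real (conf (\<phi> x)))\<^sup>2) i x"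
proof -
  define u where "u = cpx (\<phi> x)"
  define s where "s = (of_real (conf (\<phi> x)) :: complex)"
  have s: "s = 1 + u * cnj u" "s \<noteq> 0"
    by (simp_all add: s_def u_def of_real_conf[symmetric])
  \<comment> \<open>\<open>Re\<close> is kept folded: the simplifier would expand it into coordinates.\<close>
  define r where "r = Re (cnj u * w)"
  have re: "2 * of_real r = cnj u * w + u * cnj w"
    by (simp add: r_def complex_eq_iff)
  have eq: "of_real (- 2 / conf (\<phi> x)) * cnj w +
     of_real ((0 * conf (\<phi> x) - (- 2) * (2 * r)) / (conf (\<phi> x) * conf (\<phi> x))) * cnj u
     = - 2 * (cnj w - (cnj u)\<^sup>2 * w) / s\<^sup>2" (is "?l = _")
  proof -
    have "?l = - 2 / s * cnj w + 2 * (cnj u * w + u * cnj w) / (s * s) * cnj u"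
      unfolding re[symmetric] s_def by simp
    also have "\<dots> = - 2 * (s * cnj w - (cnj u * w + u * cnj w) * cnj u) / s\<^sup>2"
      using s(2) by (simp add: field_simps power2_eq_square)
    also have "s * cnj w - (cnj u * w + u * cnj w) * cnj u = cnj w - (cnj u)\<^sup>2 * w"
      by (simp add: s algebra_simps power2_eq_square)
    finally show ?thesis .
  qed
  show ?thesis unfolding gam_def
    by (rule has_partial_eqI, (rule has_partial_mult has_partial_of_real has_partial_divide
        has_partial_const has_partial_conf_comp has_partial_cnj assms | (simp; fail))+)
      (use eq in \<open>simp only: u_def s_def r_def\<close>)
qed

lemma levi_civita_const_cpx:
  "cpx (levi_civita sphere_metric X (\<lambda>_. v) x) = gam x * cpx (X x) * cpx v"
proof -
  have "cpx_partial i (\<lambda>_. v) x = 0" for i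
    by (intro cpx_partial_eqI has_partial_const)
  thus ?thesis by (simp add: levi_civita_cpx)
qed

lemma levi_civita_levi_civita_const_cpx:
  "cpx (levi_civita sphere_metric (\<lambda>_. u) (levi_civita sphere_metric (\<lambda>_. v) (\<lambda>_. w)) p) =
    (- 2 * (cnj (cpx u) - (cnj (cpx p))\<^sup>2 * cpx u) / (of_real (conf p))\<^sup>2
      + gam p * gam p * cpx u) * cpx v * cpx w"
proof -
  define G where "G z = - 2 * (cnj z - (cnj (cpx p))\<^sup>2 * z) / (of_real (conf p))\<^sup>2" for z
  have "cpx_partial i (levi_civita sphere_metric (\<lambda>_. v) (\<lambda>_. w)) p =
      G (cpx (axis i 1)) * cpx v * cpx w" for i
    unfolding G_def
    by (rule cpx_partial_eqI, unfold levi_civita_const_cpx, rule has_partial_eqI,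
      (rule has_partial_mult has_partial_const has_partial_gam_comp has_partial_cpx)+) simp
  \<comment> \<open>\<open>G\<close> is real linear, so the coordinate derivatives combine to the derivative along \<open>u\<close>.\<close>
  moreover have "u $ 1 *\<^sub>R G (cpx (axis 1 1)) + u $ 2 *\<^sub>R G (cpx (axis 2 1)) = G (cpx u)"
  proof -
    have "cpx u = u $ 1 *\<^sub>R cpx (axis 1 1) + u $ 2 *\<^sub>R cpx (axis 2 1)"
      by (simp add: complex_eq_iff axis_def)
    thus ?thesis by (simp add: G_def scaleR_conv_of_real add_divide_distrib[symmetric]
          algebra_simps)
  qed
  moreover have "u $ 1 *\<^sub>R (a * cpx v * cpx w) + u $ 2 *\<^sub>R (b * cpx v * cpx w) =
      (u $ 1 *\<^sub>R a + u $ 2 *\<^sub>R b) * cpx v * cpx w" for a b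
    by (simp add: algebra_simps)
  ultimately
  have "cpx (levi_civita sphere_metric (\<lambda>_. u) (levi_civita sphere_metric (\<lambda>_. v) (\<lambda>_. w)) p) =
      G (cpx u) * cpx v * cpx w + gam p * cpx u * (gam p * cpx v * cpx w)"
    by (simp add: levi_civita_cpx[of _ "levi_civita _ _ _"] sum_2 levi_civita_const_cpx)
  thus ?thesis by (simp add: G_def algebra_simps)
qed

lemma partial_deriv_const [simp]: "partial_deriv i (\<lambda>_. k) x = 0"
  by (rule partial_deriv_eqI[OF has_partial_const])

lemma lie_bracket_const: "lie_bracket (\<lambda>_. u) (\<lambda>_. v) = (\<lambda>_. 0)"
  by (simp add: lie_bracket_def fun_eq_iff vec_eq_iff)

text \<open>
  Antisymmetrizing removes the terms symmetric in \<open>u\<close> and \<open>v\<close>, in particular those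
  quadratic in the connection. What remains is curvature \<open>1\<close>: with
  \<open>\<langle>a,b\<rangle> = 4 Re (cnj a b) / (1 + \<bar>p\<bar>\<^sup>2)\<^sup>2\<close> the
  right-hand side equals \<open>\<langle>v,w\<rangle> u - \<langle>u,w\<rangle> v\<close>.
\<close>

lemma curvature_sphere_cpx:
  "cpx (curvature_at sphere_metric p u v w) =
     - 2 * (cnj (cpx u) * cpx v - cpx u * cnj (cpx v)) * cpx w / (of_real (conf p))\<^sup>2"
  unfolding curvature_at_def curvature_def lie_bracket_const cpx_diff
    levi_civita_levi_civita_const_cpx levi_civita_const_cpx
  by (simp add: field_simps)

section \<open>Tension and bitension fields of maps between spheres\<close>

lemma metric_trace_sphere:
  "cpx (metric_trace sphere_metric B x) = of_real ((conf x)\<^sup>2 / 4) *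
     (\<Sum>i\<in>UNIV. cpx (B (coord_field i) (coord_field i) x))"
proof -
  have "cpx (metric_trace sphere_metric B x) = ((conf x)\<^sup>2 / 4) *\<^sub>R
     (\<Sum>i\<in>UNIV. cpx (B (coord_field i) (coord_field i) x))"
    by (simp add: metric_trace_def matrix_inv_sphere mat_def sum_2 cpx_add cpx_scaleR
        scaleR_add_right)
  thus ?thesis by (simp add: scaleR_conv_of_real)
qed

text \<open>
  This is the reason why harmonicity of maps from a surface is conformally invariant. Here the
  two terms are \<open>\<Gamma> \<cdot> 1\<^sup>2\<close> and \<open>\<Gamma> \<cdot> \<i>\<^sup>2\<close>.
\<close>

lemma trace_levi_civita_sphere:
  "(\<Sum>i\<in>UNIV. levi_civita sphere_metric (coord_field i) (coord_field i) x) = 0"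
proof -
  have "cpx (levi_civita sphere_metric (coord_field i) (coord_field i) x) =
      gam x * (cpx (axis i 1))\<^sup>2" for i
    unfolding coord_field_def levi_civita_const_cpx by (simp add: power2_eq_square)
  moreover have "cpx (axis 1 1) = 1" "cpx (axis 2 1) = \<i>"
    by (simp_all add: complex_eq_iff axis_def)
  ultimately show ?thesis
    by (simp add: cpx_eq_0_iff[symmetric] sum_2 cpx_add)
qed

lemma sum_trace_levi_civita_sphere:
  fixes f :: "2 \<Rightarrow> complex"
  shows "(\<Sum>i\<in>UNIV. \<Sum>j\<in>UNIV.
    levi_civita sphere_metric (coord_field i) (coord_field i) x $ j *\<^sub>R f j) = 0"
  using trace_levi_civita_sphere[of x]
  by (subst sum.swap) (simp add: scaleR_sum_left[symmetric] sum_component[symmetric])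

lemma tension_sphere_cpx:
  "cpx (tension_field sphere_metric sphere_metric \<phi> x) = of_real ((conf x)\<^sup>2 / 4) *
    (\<Sum>i\<in>UNIV. cpx (pullback_connection sphere_metric \<phi> (coord_field i)
      (differential \<phi> (coord_field i)) x))"
  unfolding tension_field_def metric_trace_sphere second_fundamental_form_def cpx_diff
    sum_subtractf
  by (simp add: differential_cpx[of \<phi> "levi_civita _ _ _"] sum_trace_levi_civita_sphere)

lemma bitension_sphere_cpx:
  fixes \<phi> :: "real^2 \<Rightarrow> real^2"
  defines "\<tau> \<equiv> tension_field sphere_metric sphere_metric \<phi>"
  shows "cpx (bitension_field sphere_metric sphere_metric \<phi> x) = of_real ((conf x)\<^sup>2 / 4) *
    (\<Sum>i\<in>UNIV. cpx (pullback_connection sphere_metric \<phi> (coord_field i)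
            (pullback_connection sphere_metric \<phi> (coord_field i) \<tau>) x)
       - cpx (curvature_at sphere_metric (\<phi> x) (differential \<phi> (coord_field i) x) (\<tau> x)
            (differential \<phi> (coord_field i) x)))"
proof -
  have "(\<Sum>i\<in>UNIV. cpx (pullback_connection sphere_metric \<phi>
          (levi_civita sphere_metric (coord_field i) (coord_field i)) \<tau> x)) = 0"
    by (simp add: pullback_connection_cpx differential_cpx sum.distrib
        sum_trace_levi_civita_sphere
        flip: sum_distrib_left sum_distrib_right)
  thus ?thesis
    unfolding bitension_field_def cpx_diff metric_trace_sphere second_covariant_derivative_def
      \<tau>_def[symmetric]
    by (simp add: sum_subtractf cpx_diff right_diff_distrib)
qed

section \<open>Linear maps between spheres\<close>

locale linear_map_of_spheres =
  fixes \<phi> :: "real^2 \<Rightarrow> real^2" and A :: "2 \<Rightarrow> complex"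
  assumes lin: "cpx (\<phi> p) = p $ 1 *\<^sub>R A 1 + p $ 2 *\<^sub>R A 2"
begin

abbreviation w :: "real^2 \<Rightarrow> complex" where "w p \<equiv> cpx (\<phi> p)"
abbreviation s :: "real^2 \<Rightarrow> real" where "s p \<equiv> conf (\<phi> p)"

text \<open>
  In Wirtinger derivatives \<open>H = 4 (\<partial>w / \<partial>z) (\<partial>w / \<partial>cnj z)\<close>, which vanishes exactly if the map is
  holomorphic or antiholomorphic. \<open>E\<close> is twice the flat energy density.
\<close>

definition H :: complex where "H = (\<Sum>i\<in>UNIV. (A i)\<^sup>2)"
definition E :: complex where "E = (\<Sum>i\<in>UNIV. A i * cnj (A i))"

lemma has_partial_phi: "has_partial (\<lambda>y. cpx (\<phi> y)) (A i) i p"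
  unfolding lin scaleR_conv_of_real
  by (rule has_partial_eqI, (rule has_partial_add has_partial_mult has_partial_of_real
        has_partial_const has_partial_nth)+) (use exhaust_2[of i] in auto)

definition s_deriv :: "2 \<Rightarrow> real^2 \<Rightarrow> real" where "s_deriv i p = 2 * Re (cnj (w p) * A i)"

lemma has_partial_s: "has_partial s (s_deriv i p) i p"
  unfolding s_deriv_def by (rule has_partial_conf_comp[OF has_partial_phi])

lemma has_partial_s_deriv: "has_partial (s_deriv i) (2 * (cmod (A i))\<^sup>2) i p"
  unfolding s_deriv_def[abs_def]
  by (rule has_partial_eqI, (rule has_partial_mult has_partial_const has_partial_Re
        has_partial_cnj has_partial_phi)+)
    (simp add: cmod_power2, simp add: power2_eq_square)

text \<open>
  The real factor of the tension field. Only its unmixed second derivatives enter the bitension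
  field, because the domain metric is conformally flat.
\<close>

definition rho :: "real^2 \<Rightarrow> real" where "rho p = (conf p)\<^sup>2 / s p"

definition rho_deriv :: "2 \<Rightarrow> real^2 \<Rightarrow> real" where
  "rho_deriv i p = 4 * p $ i * conf p / s p - (conf p)\<^sup>2 * s_deriv i p / (s p)\<^sup>2"

definition rho_deriv2 :: "2 \<Rightarrow> real^2 \<Rightarrow> real" where
  "rho_deriv2 i p = (4 * conf p + 8 * (p $ i)\<^sup>2) / s p - 8 * p $ i * conf p * s_deriv i p / (s p)\<^sup>2
     - 2 * (cmod (A i))\<^sup>2 * (conf p)\<^sup>2 / (s p)\<^sup>2 + 2 * (conf p)\<^sup>2 * (s_deriv i p)\<^sup>2 / s p ^ 3"

lemma has_partial_rho: "has_partial rho (rho_deriv i p) i p"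
  unfolding rho_def[abs_def] power2_eq_square
  by (rule has_partial_eqI, (rule has_partial_mult has_partial_divide has_partial_conf
        has_partial_s | (simp; fail))+)
    (simp add: rho_deriv_def power2_eq_square diff_divide_distrib)

lemma has_partial_rho_deriv: "has_partial (rho_deriv i) (rho_deriv2 i p) i p"
  unfolding rho_deriv_def[abs_def] power2_eq_square
  by (rule has_partial_eqI, (rule has_partial_mult has_partial_divide has_partial_conf
        has_partial_s has_partial_const has_partial_minus has_partial_s_deriv
        has_partial_nth | (simp; fail))+)
    (simp add: rho_deriv2_def power2_eq_square power3_eq_cube field_simps)

text \<open>
  The differential of a linear map has constant coefficients, so only the Christoffel term of the
  target contributes, and it is quadratic in the \<open>A i\<close>.
\<close>

lemma tension_cpx:
  "cpx (tension_field sphere_metric sphere_metric \<phi> p) = - (H / 2) * of_real (rho p) * cnj (w p)"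
proof -
  have "has_partial (\<lambda>y. cpx (differential \<phi> (coord_field i) y)) 0 i p" for i
    unfolding differential_coord_cpx[OF has_partial_phi] by (rule has_partial_const)
  hence "cpx (pullback_connection sphere_metric \<phi> (coord_field i)
      (differential \<phi> (coord_field i)) p) =
      gam (\<phi> p) * (A i)\<^sup>2" for i
    using pullback_connection_coord_cpx[OF has_partial_phi,
        of "differential \<phi> (coord_field i)" 0 i p]
    by (simp add: differential_coord_cpx[OF has_partial_phi] power2_eq_square)
  thus ?thesis
    unfolding tension_sphere_cpx
    by (simp add: H_def sum_2 gam_def rho_def add_divide_distrib algebra_simps)
qed

lemma has_partial_tension:
  "has_partial (\<lambda>y. cpx (tension_field sphere_metric sphere_metric \<phi> y))
     (- (H / 2) * (of_real (rho_deriv i p) * cnj (w p) + of_real (rho p) * cnj (A i))) i p"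
  unfolding tension_cpx
  by (rule has_partial_eqI, (rule has_partial_mult has_partial_const has_partial_of_real
        has_partial_cnj has_partial_phi has_partial_rho)+)
    (simp add: algebra_simps)

text \<open>
  For the section \<open>V = \<rho> cnj w\<close>, the three summands are its flat Laplacian (the terms with second
  derivatives of \<open>w\<close> vanish), the terms \<open>2 \<Gamma> \<Sum>\<^sub>i A\<^sub>i \<partial>\<^sub>i V\<close>, and the zeroth-order terms coming
  from the derivative of \<open>\<Gamma>\<close>, from \<open>\<Gamma>\<^sup>2\<close> and from the curvature. In the last one the terms with
  \<open>E\<close> cancel; the part with \<open>cnj H\<close> stems from the curvature, which involves the conjugate of the
  tension field.
\<close>

definition bitension_factor :: "real^2 \<Rightarrow> complex" where
  "bitension_factor p =
     (\<Sum>i\<in>UNIV. of_real (rho_deriv2 i p) * cnj (w p) + 2 * of_real (rho_deriv i p) * cnj (A i))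
     - 4 * cnj (w p) / of_real (s p) *
        (cnj (w p) * (\<Sum>i\<in>UNIV. of_real (rho_deriv i p) * A i) + of_real (rho p) * E)
     + of_real (rho p) * (6 * cnj (w p) ^ 3 * H - 2 * cnj H * w p) / of_real ((s p)\<^sup>2)"

text \<open>
  One summand of the trace. Here \<open>H\<close> is not yet a factor: the last term has \<open>cnj H\<close> instead.
\<close>

lemma bitension_term_cpx:
  fixes p i
  defines "\<tau> \<equiv> tension_field sphere_metric sphere_metric \<phi>"
  shows "cpx (pullback_connection sphere_metric \<phi> (coord_field i)
            (pullback_connection sphere_metric \<phi> (coord_field i) \<tau>) p)
       - cpx (curvature_at sphere_metric (\<phi> p) (differential \<phi> (coord_field i) p) (\<tau> p)
            (differential \<phi> (coord_field i) p)) =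
    - (H / 2) * (of_real (rho_deriv2 i p) * cnj (w p) + 2 * of_real (rho_deriv i p) * cnj (A i))
     + 2 * H * (cnj (w p) / of_real (s p)) *
         (cnj (w p) * (of_real (rho_deriv i p) * A i) + of_real (rho p) * (A i * cnj (A i)))
     - (H / 2) * of_real (rho p) * (6 * cnj (w p) ^ 3 * (A i)\<^sup>2) / of_real ((s p)\<^sup>2)
     + cnj H * of_real (rho p) * w p * (A i)\<^sup>2 / of_real ((s p)\<^sup>2)"
proof -
  define F where "F y = cpx (\<tau> y)" for y
  define F1 where "F1 y =
      - (H / 2) * (of_real (rho_deriv i y) * cnj (w y) + of_real (rho y) * cnj (A i))" for y
  define F2 where "F2 =
      - (H / 2) * (of_real (rho_deriv2 i p) * cnj (w p) + 2 * of_real (rho_deriv i p) * cnj (A i))"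
  have F: "has_partial F (F1 y) i y" for y
    unfolding F_def[abs_def] F1_def \<tau>_def by (rule has_partial_tension)
  have F1: "has_partial F1 F2 i p"
    unfolding F1_def[abs_def] F2_def
    by (rule has_partial_eqI, (rule has_partial_mult has_partial_add has_partial_const
          has_partial_of_real has_partial_cnj has_partial_phi has_partial_rho
          has_partial_rho_deriv)+)
      (simp add: algebra_simps)
  define G where "G = - 2 * (cnj (A i) - (cnj (w p))\<^sup>2 * A i) / (of_real (s p))\<^sup>2"
  have gam: "has_partial (\<lambda>y. gam (\<phi> y)) G i p"
    unfolding G_def by (rule has_partial_gam_comp[OF has_partial_phi])
  have V: "cpx (pullback_connection sphere_metric \<phi> (coord_field i) \<tau> y) =
      F1 y + gam (\<phi> y) * A i * F y" for y
    using pullback_connection_coord_cpx[OF has_partial_phi F[unfolded F_def]] by (simp add: F_def)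
  have "has_partial (\<lambda>y. cpx (pullback_connection sphere_metric \<phi> (coord_field i) \<tau> y))
      (F2 + (gam (\<phi> p) * A i * F1 p + G * A i * F p)) i p"
    unfolding V
    by (rule has_partial_eqI, (rule has_partial_mult has_partial_add has_partial_const
          F F1 gam)+) simp
  from pullback_connection_coord_cpx[OF has_partial_phi this]
  have 1: "cpx (pullback_connection sphere_metric \<phi> (coord_field i)
            (pullback_connection sphere_metric \<phi> (coord_field i) \<tau>) p)
     = F2 + 2 * gam (\<phi> p) * A i * F1 p + G * A i * F p + (gam (\<phi> p))\<^sup>2 * (A i)\<^sup>2 * F p"
    by (simp add: V algebra_simps power2_eq_square)
  have 2: "cpx (curvature_at sphere_metric (\<phi> p) (differential \<phi> (coord_field i) p) (\<tau> p)
            (differential \<phi> (coord_field i) p)) =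
      - 2 * (cnj (A i) * F p - A i * cnj (F p)) * A i / (of_real (s p))\<^sup>2"
    unfolding curvature_sphere_cpx differential_coord_cpx[OF has_partial_phi] F_def ..
  have 3: "F p = - (H / 2) * of_real (rho p) * cnj (w p)"
    unfolding F_def \<tau>_def by (rule tension_cpx)
  show ?thesis
    unfolding 1 2 3 F1_def F2_def[symmetric] G_def gam_def
    by (simp add: divide_simps power2_eq_square power3_eq_cube) (simp add: algebra_simps)
qed

text \<open>
  The curvature term contains \<open>cnj H\<close> in place of \<open>H\<close>, but also the factor \<open>\<Sum>\<^sub>i A\<^sub>i\<^sup>2 = H\<close>; this is
  why \<open>H\<close> divides the whole bitension field.
\<close>

lemma bitension_cpx:
  "cpx (bitension_field sphere_metric sphere_metric \<phi> p) =
     - (H / 2) * of_real ((conf p)\<^sup>2 / 4) * bitension_factor p"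
  unfolding bitension_sphere_cpx bitension_term_cpx bitension_factor_def
  by (simp add: sum_2 H_def[unfolded sum_2] E_def[unfolded sum_2])
     (simp add: field_simps)

section \<open>Asymptotics of the bitension field along the axes\<close>

text \<open>
  At the point \<open>t\<close> of the \<open>i\<close>-th axis, \<open>bitension_factor\<close> divided by \<open>t\<close> is a polynomial in
  \<open>\<kappa> = (1 + t\<^sup>2) / s\<close>, \<open>\<theta> = t\<^sup>2 / s\<close> and \<open>\<epsilon> = 1 / s\<close>, where \<open>s = 1 + \<bar>A i\<bar>\<^sup>2 t\<^sup>2\<close>. This is
  that polynomial; \<open>j\<close> stands for the other index. For \<open>A i \<noteq> 0\<close> the three quotients converge as
  \<open>t\<close> tends to infinity, so the limit of the whole is a matter of substitution.
\<close>

definition axis_profile :: "2 \<Rightarrow> 2 \<Rightarrow> real \<Rightarrow> real \<Rightarrow> real \<Rightarrow> complex" where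
  "axis_profile i j \<kappa> \<theta> \<epsilon> =
    (let N = (cmod (A i))\<^sup>2; K = (cmod (A j))\<^sup>2; M = Re (cnj (A i) * A j) in
      of_real (8 * \<kappa> + 8 * \<theta> - 16 * N * \<kappa> * \<theta> - 2 * (N + K) * \<kappa>\<^sup>2
        + 8 * \<kappa>\<^sup>2 * \<theta> * (N\<^sup>2 + M\<^sup>2)) * cnj (A i)
      + 2 * of_real (4 * \<kappa> - 2 * N * \<kappa>\<^sup>2) * cnj (A i) - 4 * of_real (M * \<kappa>\<^sup>2) * cnj (A j)
      - 4 * (cnj (A i))\<^sup>2 * of_real \<theta> *
          (of_real (4 * \<kappa> - 2 * N * \<kappa>\<^sup>2) * A i - 2 * of_real (M * \<kappa>\<^sup>2) * A j)
      - 4 * cnj (A i) * of_real (\<kappa>\<^sup>2) * E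
      + of_real (\<kappa>\<^sup>2) * (6 * of_real \<theta> * cnj (A i) ^ 3 * H - 2 * of_real \<epsilon> * cnj H * A i))"

lemma bitension_factor_axis:
  fixes t :: real
  assumes ij: "i \<noteq> j"
  defines "p \<equiv> t *\<^sub>R axis i 1" and "D \<equiv> 1 + (cmod (A i))\<^sup>2 * t\<^sup>2"
  shows "bitension_factor p = of_real t * axis_profile i j ((1 + t\<^sup>2) / D) (t\<^sup>2 / D) (1 / D)"
proof -
  define N K M where "N = (cmod (A i))\<^sup>2" and "K = (cmod (A j))\<^sup>2" and "M = Re (cnj (A i) * A j)"
  define \<kappa> \<theta> \<epsilon> where "\<kappa> = (1 + t\<^sup>2) / D" and "\<theta> = t\<^sup>2 / D" and "\<epsilon> = 1 / D"
  have sum_ij: "sum f UNIV = f i + f j" for f :: "2 \<Rightarrow> complex"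
    using ij exhaust_2[of i] exhaust_2[of j] by (auto simp: sum_2)
  have p: "p $ i = t" "p $ j = 0" using ij by (simp_all add: p_def axis_def)
  have w: "w p = of_real t * A i"
    using exhaust_2[of i] exhaust_2[of j] ij p
    by (auto simp: lin scaleR_conv_of_real)
  have conf: "conf p = 1 + t\<^sup>2"
    using exhaust_2[of i] exhaust_2[of j] ij p by (auto simp: conf_eq)
  have s: "s p = D"
    by (simp add: conf_def w norm_mult power_mult_distrib N_def D_def mult.commute)
  have D: "D \<noteq> 0" using s conf_nonzero[of "\<phi> p"] by simp
  have s_deriv: "s_deriv i p = 2 * N * t" "s_deriv j p = 2 * M * t"
    unfolding s_deriv_def w N_def M_def by (simp_all add: cmod_power2)
      (simp_all add: power2_eq_square algebra_simps)
  \<comment> \<open>From here on \<open>1 + t\<^sup>2\<close> and \<open>t\<^sup>2\<close> are multiples of \<open>D\<close>, so that all powers of \<open>D\<close> cancel.\<close>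
  have \<kappa>: "1 + t\<^sup>2 = \<kappa> * D" and \<theta>: "t\<^sup>2 = \<theta> * D"
    using D by (simp_all add: \<kappa>_def \<theta>_def)
  have rho: "rho p = \<kappa>\<^sup>2 * D"
    unfolding rho_def conf s \<kappa> using D by (simp add: power2_eq_square)
  have rho_deriv: "rho_deriv i p = t * (4 * \<kappa> - 2 * N * \<kappa>\<^sup>2)" "rho_deriv j p = t * (- 2 * M * \<kappa>\<^sup>2)"
    unfolding rho_deriv_def conf s \<kappa> p s_deriv
    using D by (simp_all add: field_simps power2_eq_square)
  have rho_deriv2: "rho_deriv2 i p + rho_deriv2 j p = 8 * \<kappa> + 8 * \<theta> - 16 * N * \<kappa> * \<theta>
      - 2 * (N + K) * \<kappa>\<^sup>2 + 8 * \<kappa>\<^sup>2 * \<theta> * (N\<^sup>2 + M\<^sup>2)"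
  proof -
    have "rho_deriv2 i p + rho_deriv2 j p =
        8 * (\<kappa> * D) / D + 8 * t\<^sup>2 / D - 16 * N * t\<^sup>2 * (\<kappa> * D) / D\<^sup>2
        - 2 * (N + K) * (\<kappa> * D)\<^sup>2 / D\<^sup>2 + 8 * (\<kappa> * D)\<^sup>2 * t\<^sup>2 * (N\<^sup>2 + M\<^sup>2) / D ^ 3"
      unfolding rho_deriv2_def conf s p s_deriv N_def[symmetric] K_def[symmetric] \<kappa>
      by (simp add: add_divide_distrib algebra_simps power2_eq_square)
    also have "\<dots> = 8 * \<kappa> + 8 * \<theta> - 16 * N * \<kappa> * \<theta>
      - 2 * (N + K) * \<kappa>\<^sup>2 + 8 * \<kappa>\<^sup>2 * \<theta> * (N\<^sup>2 + M\<^sup>2)"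
      unfolding \<theta> using D by (simp add: power2_eq_square power3_eq_cube)
    finally show ?thesis .
  qed
  define T Dc where "T = complex_of_real t" and "Dc = complex_of_real D"
  have cnj_T: "cnj T = T" by (simp add: T_def)
  have Dc: "Dc \<noteq> 0" using D by (simp add: Dc_def)
  have \<theta>\<epsilon>: "complex_of_real \<theta> = T\<^sup>2 / Dc" "complex_of_real \<epsilon> = 1 / Dc"
    by (simp_all add: \<theta>_def \<epsilon>_def T_def Dc_def)
  define L where "L = rho_deriv2 i p + rho_deriv2 j p"
  define a b k where "a = complex_of_real (4 * \<kappa> - 2 * N * \<kappa>\<^sup>2)"
    and "b = complex_of_real (M * \<kappa>\<^sup>2)" and "k = complex_of_real (\<kappa>\<^sup>2)"
  have of_real_eqs: "complex_of_real (rho_deriv i p) = T * a"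
    "complex_of_real (rho_deriv j p) = - 2 * T * b"
    "complex_of_real (rho p) = k * Dc"
    by (simp_all add: rho_deriv rho a_def b_def k_def T_def Dc_def)
  have "bitension_factor p = of_real L * (T * cnj (A i))
      + 2 * (T * a) * cnj (A i) - 4 * T * b * cnj (A j)
      - 4 * (T * cnj (A i)) / Dc * (T * cnj (A i) * (T * a * A i - 2 * T * b * A j) + k * Dc * E)
      + k * Dc * (6 * (T * cnj (A i)) ^ 3 * H - 2 * cnj H * (T * A i)) / Dc\<^sup>2"
    unfolding bitension_factor_def sum_ij of_real_eqs w s L_def T_def[symmetric]
      complex_cnj_mult cnj_T
    by (simp add: Dc_def[symmetric] algebra_simps)
  also have "\<dots> = T * (of_real L * cnj (A i) + 2 * a * cnj (A i) - 4 * b * cnj (A j)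
      - 4 * (cnj (A i))\<^sup>2 * (T\<^sup>2 / Dc) * (a * A i - 2 * b * A j)
      - 4 * cnj (A i) * k * E
      + k * (6 * (T\<^sup>2 / Dc) * cnj (A i) ^ 3 * H - 2 * (1 / Dc) * cnj H * A i))"
    using Dc by (simp add: field_simps power2_eq_square power3_eq_cube)
  finally show ?thesis
    unfolding \<kappa>_def[symmetric] \<theta>_def[symmetric] \<epsilon>_def[symmetric] axis_profile_def Let_def
      N_def[symmetric] K_def[symmetric] M_def[symmetric] rho_deriv2[symmetric]
      L_def[symmetric] a_def[symmetric] b_def[symmetric] k_def[symmetric]
      T_def[symmetric] \<theta>\<epsilon> .
qed

text \<open>
  The substitution \<open>\<kappa> = \<theta> = 1 / N\<close>, \<open>\<epsilon> = 0\<close>, with the conjugates \<open>a'\<close>, \<open>b'\<close> as independent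
  variables: multiplied by \<open>n\<^sup>3\<close>, the polynomial is \<open>a'\<^sup>3 (12 h - 8 a\<^sup>2)\<close>. All terms in \<open>m\<close> are
  absorbed because \<open>a'\<^sup>2 b\<^sup>2 = (2 m - a b')\<^sup>2\<close>.
\<close>

lemma axis_limit_algebra:
  fixes a a' b b' m n k h :: complex
  assumes nz: "n \<noteq> 0" and n: "n = a * a'" and k: "k = 1 / n"
    and m: "2 * m = a' * b + a * b'" and h: "h = a\<^sup>2 + b\<^sup>2"
    and zero: "(8 * k + 8 * k - 16 * n * k * k - 2 * (n + b * b') * k\<^sup>2
        + 8 * k\<^sup>2 * k * (n\<^sup>2 + m\<^sup>2)) * a'
      + 2 * (4 * k - 2 * n * k\<^sup>2) * a' - 4 * (m * k\<^sup>2) * b'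
      - 4 * a'\<^sup>2 * k * ((4 * k - 2 * n * k\<^sup>2) * a - 2 * (m * k\<^sup>2) * b)
      - 4 * a' * k\<^sup>2 * (a * a' + b * b') + k\<^sup>2 * (6 * k * a' ^ 3 * h) = 0"
  shows "2 * a\<^sup>2 = 3 * h"
proof -
  have "(8 * n\<^sup>2 + 8 * m\<^sup>2 - 2 * (n + b * b') * n) * a' + 4 * n\<^sup>2 * a' - 4 * m * n * b'
      - 4 * a'\<^sup>2 * (2 * n * a - 2 * m * b) - 4 * a' * n * (a * a' + b * b')
      + 6 * a' ^ 3 * h = 0" (is "?e = 0")
  proof -
    have "?e / n ^ 3 = 0"
      using nz by (subst zero[symmetric]) (simp add: k field_simps power2_eq_square
          power3_eq_cube)
    thus ?thesis using nz by simp
  qed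
  moreover have m': "m = (a' * b + a * b') / 2" using m by (simp add: mult.commute)
  have "?e = a' ^ 3 * (12 * h - 8 * a\<^sup>2)"
    unfolding n h m' by (simp add: field_simps power2_eq_square power3_eq_cube)
  ultimately have "12 * h - 8 * a\<^sup>2 = 0" using nz n by simp
  thus ?thesis by simp
qed

text \<open>
  The limit of \<open>bitension_factor\<close> divided by \<open>t\<close> at infinity is decisive. The leading term at the
  origin, \<open>(16 - 8 E) cnj w - 4 cnj H w\<close>, would not suffice: it vanishes for \<open>A 1 = sqrt (4 / 3)\<close>
  and \<open>A 2 = 0\<close>, where \<open>H = 4 / 3\<close>.
\<close>

lemma bitension_factor_zero_imp:
  assumes ij: "i \<noteq> j" and Ai: "A i \<noteq> 0" and zero: "\<And>p. bitension_factor p = 0"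
  shows "2 * (A i)\<^sup>2 = 3 * H"
proof -
  define N K M where "N = (cmod (A i))\<^sup>2" and "K = (cmod (A j))\<^sup>2" and "M = Re (cnj (A i) * A j)"
  have N: "N > 0" using Ai by (simp add: N_def)
  define \<kappa> where "\<kappa> t = (1 + t\<^sup>2) / (1 + N * t\<^sup>2)" for t :: real
  define \<theta> where "\<theta> t = t\<^sup>2 / (1 + N * t\<^sup>2)" for t :: real
  define \<epsilon> where "\<epsilon> t = 1 / (1 + N * t\<^sup>2)" for t :: real
  \<comment> \<open>Both \<open>\<kappa>\<close> and \<open>\<theta>\<close> are affine in \<open>\<epsilon>\<close>, so only \<open>\<epsilon>\<close> needs a limit at infinity.\<close>
  have "filterlim (\<lambda>t. 1 + N * t\<^sup>2) at_top at_top"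
    by (intro filterlim_tendsto_add_at_top[OF tendsto_const]
        filterlim_tendsto_pos_mult_at_top[OF tendsto_const N] filterlim_pow_at_top
        filterlim_ident) simp
  hence \<epsilon>: "(\<epsilon> \<longlongrightarrow> 0) at_top"
    unfolding \<epsilon>_def[abs_def]
    by (intro tendsto_divide_0[OF tendsto_const] filterlim_at_top_imp_at_infinity)
  have pos: "1 + N * t\<^sup>2 > 0" for t using N by (simp add: add_pos_nonneg)
  have "\<theta> = (\<lambda>t. (1 - \<epsilon> t) / N)" "\<kappa> = (\<lambda>t. \<epsilon> t + (1 - \<epsilon> t) / N)"
    using N pos[THEN less_imp_neq] by (auto simp: fun_eq_iff \<theta>_def \<kappa>_def \<epsilon>_def divide_simps)
  moreover have \<theta>: "((\<lambda>t. (1 - \<epsilon> t) / N) \<longlongrightarrow> (1 - 0) / N) at_top"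
    using N by (intro tendsto_divide tendsto_diff tendsto_const \<epsilon>) simp
  moreover have "((\<lambda>t. \<epsilon> t + (1 - \<epsilon> t) / N) \<longlongrightarrow> 0 + (1 - 0) / N) at_top"
    by (rule tendsto_add[OF \<epsilon> \<theta>])
  ultimately have "(\<theta> \<longlongrightarrow> 1 / N) at_top" "(\<kappa> \<longlongrightarrow> 1 / N) at_top"
    by simp_all
  with \<epsilon> have "((\<lambda>t. axis_profile i j (\<kappa> t) (\<theta> t) (\<epsilon> t))
      \<longlongrightarrow> axis_profile i j (1 / N) (1 / N) 0) at_top"
    unfolding axis_profile_def Let_def by (intro tendsto_intros)
  moreover have "\<forall>\<^sub>F t in at_top. axis_profile i j (\<kappa> t) (\<theta> t) (\<epsilon> t) = 0"
    using eventually_gt_at_top[of 0]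
  proof eventually_elim
    case (elim t)
    have "of_real t * axis_profile i j (\<kappa> t) (\<theta> t) (\<epsilon> t) = bitension_factor (t *\<^sub>R axis i 1)"
      unfolding \<kappa>_def \<theta>_def \<epsilon>_def N_def by (rule bitension_factor_axis[OF ij, symmetric])
    thus ?case using elim zero by simp
  qed
  ultimately have lim: "axis_profile i j (1 / N) (1 / N) 0 = 0"
    by (rule tendsto_unique[OF trivial_limit_at_top_linorder _ tendsto_eventually])
  have sum_ij: "sum f UNIV = f i + f j" for f :: "2 \<Rightarrow> complex"
    using ij exhaust_2[of i] exhaust_2[of j] by (auto simp: sum_2)
  show ?thesis
  proof (rule axis_limit_algebra)
    show "complex_of_real N \<noteq> 0" using N by simp
    show "complex_of_real N = A i * cnj (A i)"
      unfolding N_def by (rule complex_norm_square)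
    show "complex_of_real (1 / N) = 1 / complex_of_real N" by simp
    show "2 * complex_of_real M = cnj (A i) * A j + A i * cnj (A j)"
      by (simp add: M_def complex_eq_iff)
    show "H = (A i)\<^sup>2 + (A j)\<^sup>2" by (simp add: H_def sum_ij)
    have K: "A j * cnj (A j) = of_real K"
      unfolding K_def by (rule complex_norm_square[symmetric])
    let ?k = "complex_of_real (1 / N)" and ?n = "complex_of_real N" and ?m = "complex_of_real M"
    show "(8 * ?k + 8 * ?k - 16 * ?n * ?k * ?k - 2 * (?n + A j * cnj (A j)) * ?k\<^sup>2
        + 8 * ?k\<^sup>2 * ?k * (?n\<^sup>2 + ?m\<^sup>2)) * cnj (A i)
      + 2 * (4 * ?k - 2 * ?n * ?k\<^sup>2) * cnj (A i) - 4 * (?m * ?k\<^sup>2) * cnj (A j)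
      - 4 * (cnj (A i))\<^sup>2 * ?k * ((4 * ?k - 2 * ?n * ?k\<^sup>2) * A i - 2 * (?m * ?k\<^sup>2) * A j)
      - 4 * cnj (A i) * ?k\<^sup>2 * (A i * cnj (A i) + A j * cnj (A j))
      + ?k\<^sup>2 * (6 * ?k * cnj (A i) ^ 3 * H) = 0"
      unfolding lim[symmetric] axis_profile_def Let_def E_def sum_ij K
        N_def[symmetric] K_def[symmetric] M_def[symmetric]
      by (simp only: of_real_add of_real_diff of_real_mult of_real_power of_real_numeral of_real_0
          mult_zero_left mult_zero_right diff_zero)
  qed
qed

section \<open>Harmonicity and biharmonicity\<close>

lemma harmonic_iff: "harmonic_map sphere_metric sphere_metric \<phi> \<longleftrightarrow> H = 0"
proof
  assume "harmonic_map sphere_metric sphere_metric \<phi>"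
  hence "cpx (tension_field sphere_metric sphere_metric \<phi> p) = 0" for p
    by (simp add: harmonic_map_def)
  hence "H = 0 \<or> w p = 0" for p
    unfolding tension_cpx by (simp add: rho_def)
  moreover have "w (axis i 1) = A i" for i
    using exhaust_2[of i] by (auto simp: lin axis_def)
  ultimately have "H = 0 \<or> (\<forall>i. A i = 0)" by metis
  thus "H = 0" by (auto simp: H_def)
next
  assume "H = 0"
  hence "cpx (tension_field sphere_metric sphere_metric \<phi> p) = 0" for p
    unfolding tension_cpx by simp
  thus "harmonic_map sphere_metric sphere_metric \<phi>"
    by (simp add: harmonic_map_def cpx_eq_0_iff)
qed

lemma biharmonic_iff: "biharmonic_map sphere_metric sphere_metric \<phi> \<longleftrightarrow> H = 0"
proof
  assume bih: "biharmonic_map sphere_metric sphere_metric \<phi>"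
  show "H = 0"
  proof (rule ccontr)
    assume "H \<noteq> 0"
    have "cpx (bitension_field sphere_metric sphere_metric \<phi> p) = 0" for p
      using bih by (simp add: biharmonic_map_def)
    hence zero: "bitension_factor p = 0" for p
      unfolding bitension_cpx using \<open>H \<noteq> 0\<close> by simp
    have dichotomy: "A i = 0 \<or> 2 * (A i)\<^sup>2 = 3 * H" for i
    proof -
      obtain j :: 2 where "i \<noteq> j" by (cases "i = 1") (auto intro: that[of 1] that[of 2])
      thus ?thesis using bitension_factor_zero_imp[of i j] zero by blast
    qed
    have "2 * H = 2 * (A 1)\<^sup>2 + 2 * (A 2)\<^sup>2" by (simp add: H_def sum_2)
    thus False using dichotomy[of 1] dichotomy[of 2] \<open>H \<noteq> 0\<close> by auto
  qed
next
  assume "H = 0"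
  hence "cpx (bitension_field sphere_metric sphere_metric \<phi> p) = 0" for p
    unfolding bitension_cpx by simp
  thus "biharmonic_map sphere_metric sphere_metric \<phi>"
    by (simp add: biharmonic_map_def cpx_eq_0_iff)
qed

end

theorem proposition2p4:
  fixes a b c d :: real
    and \<phi> :: "real^2 \<Rightarrow> real^2"
    and A1 A2 :: "real^2"
  assumes phi: "\<phi> = (\<lambda>p. vector [a * p $ 1 + b * p $ 2, c * p $ 1 + d * p $ 2])"
    and A1: "A1 = vector [a, b]"
    and A2: "A2 = vector [c, d]"
  shows "(biharmonic_map sphere_metric sphere_metric \<phi> \<longleftrightarrow>
            harmonic_map sphere_metric sphere_metric \<phi>)
       \<and> (harmonic_map sphere_metric sphere_metric \<phi> \<longleftrightarrow>
            \<phi> constant_on UNIV \<or> ((norm A1)\<^sup>2 = (norm A2)\<^sup>2 \<and> A1 \<bullet> A2 = 0))"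
proof -
  \<comment> \<open>\<open>B i\<close> is the \<open>i\<close>-th column of the matrix, whereas \<open>A1\<close> and \<open>A2\<close> are its rows.\<close>
  define B :: "2 \<Rightarrow> complex" where "B i = (if i = 1 then Complex a c else Complex b d)" for i
  interpret linear_map_of_spheres \<phi> B
    by unfold_locales (simp add: phi B_def complex_eq_iff algebra_simps)
  have "H = 0 \<longleftrightarrow> a\<^sup>2 + b\<^sup>2 = c\<^sup>2 + d\<^sup>2 \<and> a * c + b * d = 0"
    by (auto simp: H_def sum_2 B_def complex_eq_iff power2_eq_square)
  also have "\<dots> \<longleftrightarrow> (norm A1)\<^sup>2 = (norm A2)\<^sup>2 \<and> A1 \<bullet> A2 = 0"
    unfolding power2_norm_eq_inner by (simp add: A1 A2 inner_vec_def sum_2 power2_eq_square)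
  finally have H_iff: "H = 0 \<longleftrightarrow> (norm A1)\<^sup>2 = (norm A2)\<^sup>2 \<and> A1 \<bullet> A2 = 0" .
  have "H = 0" if "\<phi> constant_on UNIV"
  proof -
    from that have const: "\<phi> p = \<phi> 0" for p unfolding constant_on_def by (metis UNIV_I)
    have "a = 0 \<and> c = 0" "b = 0 \<and> d = 0"
      using const[of "axis 1 1"] const[of "axis 2 1"]
      by (simp_all add: phi vec_eq_iff forall_2 axis_def)
    thus ?thesis by (simp add: H_def B_def sum_2 complex_eq_iff)
  qed
  thus ?thesis using H_iff harmonic_iff biharmonic_iff by blast
qed

end
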